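(* For each integer $\ell\ge 2$, choose a boat sequence of $\ell$ people uniformly at random from all boat sequences of $\ell$ people, and let $X_\ell$ be the number of return trips in which the most skilled person among those on the opposite shore takes the boat back. Then, as $\ell\to\infty$, $$\frac{X_\ell-\log \ell}{\sqrt{\log \ell}}\ \xrightarrow{\ d\ }\ N(0,1),$$ where $\xrightarrow{\ d\ }$ denotes convergence in distribution and $N(0,1)$ the standard normal distribution.
   Context: Boat sequences: $\ell$ people, numbered $1,\dots,\ell$ and (strictly) ranked according to their skill at steering the boat (a larger number means more skilled), cross a river with a two-person boat. Alternately, two people are sent from the starting shore to the opposite shore and one person returns from the opposite shore to the starting shore (2 send, 1 returns, 2 send, 1 returns, ...), until everybody is on the opposite shore. A boat sequence is the list of pairs $S_1,\dots,S_{\ell-1}$ sent, together with the list $t_1,\dots,t_{\ell-2}$ of people returning, in the order $S_1,t_1,S_2,t_2,\dots,t_{\ell-2},S_{\ell-1}$; here each $S_i$ is an (unordered) pair of people on the starting shore at that moment and each $t_i$ is a person on the opposite shore at that moment (after the $i$-th send). $X_\ell$ is the number of $i\in\{1,\dots,\ell-2\}$ such that $t_i$ is the most skilled person among the people on the opposite shore right after the $i$-th send. *)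

theory Defs
  imports "HOL-Probability.Probability"
begin

text \<open>
  Sends and returns are indexed from 0: the list \<open>Ss\<close> holds the pairs
  \<open>S\<^sub>1, \<dots>, S\<^bsub>l-1\<^esub>\<close> and \<open>ts\<close> the people \<open>t\<^sub>1, \<dots>, t\<^bsub>l-2\<^esub>\<close>, so
  \<open>Ss ! i\<close> is \<open>S\<^bsub>i+1\<^esub>\<close> and \<open>ts ! i\<close> is \<open>t\<^bsub>i+1\<^esub>\<close>.
\<close>

text \<open>People on the starting shore just before send \<open>i\<close>.\<close>

primrec starting_shore :: "nat \<Rightarrow> nat set list \<Rightarrow> nat list \<Rightarrow> nat \<Rightarrow> nat set" where
  "starting_shore l Ss ts 0 = {1..l}"
| "starting_shore l Ss ts (Suc i) = insert (ts ! i) (starting_shore l Ss ts i - Ss ! i)"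

text \<open>People on the opposite shore right after send \<open>i\<close>, before the following return.\<close>

definition opposite_shore :: "nat \<Rightarrow> nat set list \<Rightarrow> nat list \<Rightarrow> nat \<Rightarrow> nat set" where
  "opposite_shore l Ss ts i = {1..l} - (starting_shore l Ss ts i - Ss ! i)"

definition boat_sequences :: "nat \<Rightarrow> (nat set list \<times> nat list) set" where
  "boat_sequences l = {(Ss, ts).
     length Ss = l - 1 \<and> length ts = l - 2 \<and>
     (\<forall>i < l - 1. Ss ! i \<subseteq> starting_shore l Ss ts i \<and> card (Ss ! i) = 2) \<and>
     (\<forall>i < l - 2. ts ! i \<in> opposite_shore l Ss ts i)}"

definition best_returns :: "nat \<Rightarrow> nat set list \<times> nat list \<Rightarrow> nat" where
  "best_returns l = (\<lambda>(Ss, ts).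
     card {i. i < l - 2 \<and> ts ! i = Max (opposite_shore l Ss ts i)})"

text \<open>
  The set of boat sequences is finite and nonempty, so \<^const>\<open>pmf_of_set\<close> really is the
  uniform distribution on it.
\<close>

lemma starting_shore_subset:
  assumes "(Ss, ts) \<in> boat_sequences l" "i \<le> l - 2"
  shows "starting_shore l Ss ts i \<subseteq> {1..l}"
  using assms(2)
proof (induction i)
  case (Suc i)
  then have "ts ! i \<in> opposite_shore l Ss ts i"
    using assms(1) by (auto simp: boat_sequences_def)
  with Suc show ?case by (auto simp: opposite_shore_def)
qed simp

lemma finite_boat_sequences: "finite (boat_sequences l)"
proof (rule finite_subset)
  show "boat_sequences l \<subseteq>
    {Ss. set Ss \<subseteq> Pow {1..l} \<and> length Ss = l - 1} \<times> {ts. set ts \<subseteq> {1..l} \<and> length ts = l - 2}"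
  proof (rule subrelI)
    fix Ss ts assume b: "(Ss, ts) \<in> boat_sequences l"
    have "Ss ! i \<subseteq> {1..l}" if "i < l - 1" for i
    proof -
      have "Ss ! i \<subseteq> starting_shore l Ss ts i"
        using b that by (auto simp: boat_sequences_def)
      also have "\<dots> \<subseteq> {1..l}"
        using starting_shore_subset[OF b] that by simp
      finally show ?thesis .
    qed
    moreover have "ts ! i \<in> {1..l}" if "i < l - 2" for i
      using b that unfolding boat_sequences_def opposite_shore_def by blast
    ultimately have "set Ss \<subseteq> Pow {1..l}" "set ts \<subseteq> {1..l}"
      using b unfolding boat_sequences_def by (force simp: in_set_conv_nth)+
    then show "(Ss, ts) \<in> {Ss. set Ss \<subseteq> Pow {1..l} \<and> length Ss = l - 1} \<times>
                           {ts. set ts \<subseteq> {1..l} \<and> length ts = l - 2}"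
      using b by (simp add: boat_sequences_def)
  qed
  show "finite ({Ss. set Ss \<subseteq> Pow {1..l} \<and> length Ss = l - 1} \<times>
                {ts. set ts \<subseteq> {1..l} \<and> length ts = l - 2})"
    by (intro finite_cartesian_product finite_lists_length_eq) auto
qed

lemma boat_sequences_nonempty: "boat_sequences l \<noteq> {}"
proof -
  define Ss where "Ss = map (\<lambda>i. {1, i + 2}) [0..<l - 1]"
  define ts where "ts = replicate (l - 2) (1::nat)"
  have Ss: "Ss ! i = {1, i + 2}" if "i < l - 1" for i
    using that by (simp add: Ss_def)
  have ts: "ts ! i = 1" if "i < l - 2" for i
    using that by (simp add: ts_def)
  have shore: "starting_shore l Ss ts i = insert 1 {i + 2..l}" if "i + 2 \<le> l" for i
    using that
  proof (induction i)
    case 0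
    then show ?case by auto
  next
    case (Suc i)
    have "insert 1 (insert 1 {i + 2..l} - {1, i + 2}) = insert 1 {Suc i + 2..l}"
      by auto
    with Suc Ss[of i] ts[of i] show ?case by simp
  qed
  have "Ss ! i \<subseteq> starting_shore l Ss ts i" "card (Ss ! i) = 2" if "i < l - 1" for i
    using that Ss[of i] shore[of i] by auto
  moreover have "ts ! i \<in> opposite_shore l Ss ts i" if "i < l - 2" for i
    using that Ss[of i] ts[of i] shore[of i] by (simp add: opposite_shore_def)
  ultimately have "(Ss, ts) \<in> boat_sequences l"
    unfolding boat_sequences_def by (simp add: Ss_def ts_def)
  then show ?thesis by blast
qed

end

theory Submission
  imports Defs
begin

text \<open>
  The number of ways to continue a boat sequence never depends on its past, so the uniform
  distribution lets every send and every return be chosen uniformly and independently of the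
  past. Right after the \<open>i\<close>-th send there are \<open>i + 1\<close> people on the opposite shore, hence
  \<open>X\<^sub>l\<close> is a sum of independent Bernoulli variables with parameters \<open>1 / (i + 1)\<close>,
  \<open>1 \<le> i \<le> l - 2\<close>, and its generating function is the product of the factors
  \<open>1 + (z - 1) / (i + 1)\<close>. For \<open>z = exp (\<i> t / sqrt (ln l))\<close> this product differs from
  \<open>exp ((z - 1) (H - 1))\<close>, with \<open>H\<close> the harmonic number of order \<open>l - 1\<close>, by
  \<open>O(\<bar>z - 1\<bar>\<^sup>2)\<close>. Since \<open>H - ln l\<close> is bounded, the characteristic functions converge to
  \<open>exp (- t\<^sup>2 / 2)\<close>, and Levy's continuity theorem applies.
\<close>

section \<open>Counting boat sequences\<close>

definition pairs :: "nat set \<Rightarrow> nat set set" where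
  "pairs A = {S. S \<subseteq> A \<and> card S = 2}"

text \<open>A prefix consists of \<open>n\<close> complete rounds, each a send followed by a return.
  The final send, which has no return, is left out, so every round has the same shape and induction
  on \<open>n\<close> applies.\<close>

definition crossing_prefixes :: "nat \<Rightarrow> nat \<Rightarrow> (nat set list \<times> nat list) set" where
  "crossing_prefixes l n = {(Ss, ts). length Ss = n \<and> length ts = n \<and>
     (\<forall>i<n. Ss ! i \<in> pairs (starting_shore l Ss ts i) \<and> ts ! i \<in> opposite_shore l Ss ts i)}"

text \<open>This is \<open>z\<close> to the number of rounds in which the best person returns. In
  product form, a further round contributes one further factor.\<close>

definition return_weight ::
    "'a::comm_monoid_mult \<Rightarrow> nat \<Rightarrow> nat \<Rightarrow> nat set list \<Rightarrow> nat list \<Rightarrow> 'a" where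
  "return_weight z l n Ss ts =
     (\<Prod>i<n. if ts ! i = Max (opposite_shore l Ss ts i) then z else 1)"

lemma finite_pairs: "finite A \<Longrightarrow> finite (pairs A)"
  by (simp add: pairs_def)

lemma card_pairs: "finite A \<Longrightarrow> card (pairs A) = card A choose 2"
  by (simp add: pairs_def n_subsets)

section \<open>How the shores depend on the two lists\<close>

lemma starting_shore_cong:
  assumes "\<And>j. j < i \<Longrightarrow> Ss ! j = Ss' ! j" "\<And>j. j < i \<Longrightarrow> ts ! j = ts' ! j"
  shows "starting_shore l Ss ts i = starting_shore l Ss' ts' i"
  using assms by (induction i) auto

lemma opposite_shore_cong:
  assumes "\<And>j. j \<le> i \<Longrightarrow> Ss ! j = Ss' ! j" "\<And>j. j < i \<Longrightarrow> ts ! j = ts' ! j"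
  shows "opposite_shore l Ss ts i = opposite_shore l Ss' ts' i"
  using assms starting_shore_cong[of i Ss Ss' ts ts' l] by (simp add: opposite_shore_def)

lemma starting_shore_append:
  assumes "i \<le> length Ss" "i \<le> length ts"
  shows "starting_shore l (Ss @ Ss') (ts @ ts') i = starting_shore l Ss ts i"
  using assms by (intro starting_shore_cong) (auto simp: nth_append)

lemma opposite_shore_append:
  assumes "i < length Ss" "i \<le> length ts"
  shows "opposite_shore l (Ss @ Ss') (ts @ ts') i = opposite_shore l Ss ts i"
  using assms by (intro opposite_shore_cong) (auto simp: nth_append)

lemma opposite_shore_snoc:
  assumes "length Ss = n" "length ts = n"
  shows "opposite_shore l (Ss @ [S]) (ts @ ts') n = {1..l} - (starting_shore l Ss ts n - S)"
  using assms by (simp add: opposite_shore_def starting_shore_append nth_append)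

lemma crossing_prefixes_0: "crossing_prefixes l 0 = {([], [])}"
  by (auto simp: crossing_prefixes_def)

lemma crossing_prefixes_snoc_iff:
  assumes "length Ss = n" "length ts = n"
  shows "(Ss @ [S], ts @ [t]) \<in> crossing_prefixes l (Suc n) \<longleftrightarrow>
    (Ss, ts) \<in> crossing_prefixes l n \<and> S \<in> pairs (starting_shore l Ss ts n) \<and>
    t \<in> {1..l} - (starting_shore l Ss ts n - S)"
  using assms
  by (auto simp: crossing_prefixes_def less_Suc_eq starting_shore_append
        opposite_shore_append opposite_shore_snoc nth_append)

text \<open>Prefixes form a tree: the available sends depend on the past, the available returns also
  on the send just made. The nested \<open>SIGMA\<close> keeps these dependencies and turns sums
  over prefixes into iterated sums.\<close>

lemma crossing_prefixes_Suc:
  "crossing_prefixes l (Suc n) =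
    (\<lambda>((Ss, ts), S, t). (Ss @ [S], ts @ [t])) `
      (SIGMA (Ss, ts):crossing_prefixes l n.
        SIGMA S:pairs (starting_shore l Ss ts n). {1..l} - (starting_shore l Ss ts n - S))"
  (is "_ = ?f ` ?A")
proof (intro equalityI subsetI)
  fix x assume x: "x \<in> crossing_prefixes l (Suc n)"
  obtain Ss' ts' where x': "x = (Ss', ts')" by force
  with x have "length Ss' = Suc n" "length ts' = Suc n"
    by (auto simp: crossing_prefixes_def)
  then obtain Ss S ts t where *: "Ss' = Ss @ [S]" "ts' = ts @ [t]" "length Ss = n" "length ts = n"
    by (metis length_Suc_conv_rev)
  with x x' have "((Ss, ts), S, t) \<in> ?A"
    by (simp add: crossing_prefixes_snoc_iff)
  with x' * show "x \<in> ?f ` ?A"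
    by (intro image_eqI[where x = "((Ss, ts), S, t)"]) auto
next
  fix x assume "x \<in> ?f ` ?A"
  then obtain Ss ts S t where *: "x = (Ss @ [S], ts @ [t])" "(Ss, ts) \<in> crossing_prefixes l n"
    "S \<in> pairs (starting_shore l Ss ts n)" "t \<in> {1..l} - (starting_shore l Ss ts n - S)"
    by fast
  then have "length Ss = n" "length ts = n"
    by (auto simp: crossing_prefixes_def)
  with * show "x \<in> crossing_prefixes l (Suc n)"
    by (simp add: crossing_prefixes_snoc_iff)
qed

section \<open>Sizes of the two shores\<close>

lemma starting_shore_prefix:
  assumes "(Ss, ts) \<in> crossing_prefixes l n"
  shows "starting_shore l Ss ts n \<subseteq> {1..l}" "card (starting_shore l Ss ts n) = l - n"
proof -
  have "starting_shore l Ss ts i \<subseteq> {1..l} \<and> card (starting_shore l Ss ts i) = l - i"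
    if "i \<le> n" for i
    using that
  proof (induction i)
    case (Suc i)
    let ?A = "starting_shore l Ss ts i"
    have A: "?A \<subseteq> {1..l}" "card ?A = l - i"
      using Suc by simp_all
    then have fin: "finite ?A"
      using finite_subset by blast
    have S: "Ss ! i \<subseteq> ?A" "card (Ss ! i) = 2"
      and t: "ts ! i \<in> {1..l}" "ts ! i \<notin> ?A - Ss ! i"
      using assms Suc.prems by (auto simp: crossing_prefixes_def pairs_def opposite_shore_def)
    \<comment> \<open>The existence of a pair to send rules out truncation in
      \<open>l - i - 2\<close>, so removing two people and readmitting one gives exactly
      \<open>l - Suc i\<close>.\<close>
    have "2 \<le> l - i"
      using card_mono[OF fin S(1)] S(2) A(2) by simp
    moreover have "card (?A - Ss ! i) = l - i - 2"
      using S A fin by (simp add: card_Diff_subset finite_subset)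
    ultimately have "card (insert (ts ! i) (?A - Ss ! i)) = l - Suc i"
      using t fin by simp
    then show ?case
      using A t by auto
  qed simp
  from this[of n] show "starting_shore l Ss ts n \<subseteq> {1..l}"
    "card (starting_shore l Ss ts n) = l - n" by simp_all
qed

text \<open>The send leaves \<open>l - n - 2\<close> people behind, whatever happened before. This
  independence of the past is what makes the generating function factor.\<close>

lemma card_opposite_prefix:
  assumes "(Ss, ts) \<in> crossing_prefixes l n" "S \<in> pairs (starting_shore l Ss ts n)"
  shows "card ({1..l} - (starting_shore l Ss ts n - S)) = n + 2"
proof -
  let ?A = "starting_shore l Ss ts n"
  have A: "?A \<subseteq> {1..l}" "card ?A = l - n"
    using starting_shore_prefix[OF assms(1)] by simp_all
  then have fin: "finite ?A"
    using finite_subset by blast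
  have S: "S \<subseteq> ?A" "card S = 2"
    using assms(2) by (simp_all add: pairs_def)
  have "2 \<le> l - n"
    using card_mono[OF fin S(1)] S(2) A(2) by simp
  moreover have "card (?A - S) = l - n - 2"
    using S A fin by (simp add: card_Diff_subset finite_subset)
  moreover have "card ({1..l} - (?A - S)) = l - card (?A - S)"
    using A fin by (subst card_Diff_subset) auto
  ultimately show ?thesis by simp
qed

lemma finite_crossing_prefixes: "finite (crossing_prefixes l n)"
proof (induction n)
  case 0
  then show ?case by (simp add: crossing_prefixes_0)
next
  case (Suc n)
  have "finite (pairs (starting_shore l Ss ts n))" if "(Ss, ts) \<in> crossing_prefixes l n" for Ss ts
    using starting_shore_prefix(1)[OF that] by (intro finite_pairs) (auto intro: finite_subset)
  with Suc show ?case
    unfolding crossing_prefixes_Suc by (intro finite_imageI finite_SigmaI) auto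
qed

section \<open>Generating function of the prefixes, round by round\<close>

lemma sum_crossing_prefixes_Suc:
  fixes f :: "nat set list \<times> nat list \<Rightarrow> 'a::comm_monoid_add"
  shows "sum f (crossing_prefixes l (Suc n)) =
    (\<Sum>(Ss, ts)\<in>crossing_prefixes l n. \<Sum>S\<in>pairs (starting_shore l Ss ts n).
      \<Sum>t\<in>{1..l} - (starting_shore l Ss ts n - S). f (Ss @ [S], ts @ [t]))"
proof -
  let ?B = "\<lambda>(Ss, ts). SIGMA S:pairs (starting_shore l Ss ts n). {1..l} - (starting_shore l Ss ts n - S)"
  have fin: "finite (pairs (starting_shore l Ss ts n))" if "(Ss, ts) \<in> crossing_prefixes l n" for Ss ts
    using starting_shore_prefix(1)[OF that] by (intro finite_pairs) (auto intro: finite_subset)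
  have "sum f (crossing_prefixes l (Suc n)) =
    (\<Sum>((Ss, ts), S, t)\<in>Sigma (crossing_prefixes l n) ?B. f (Ss @ [S], ts @ [t]))"
    unfolding crossing_prefixes_Suc
    by (subst sum.reindex) (auto simp: inj_on_def intro!: sum.cong)
  also have "\<dots> = (\<Sum>p\<in>crossing_prefixes l n. \<Sum>q\<in>?B p. case (p, q) of ((Ss, ts), S, t) \<Rightarrow> f (Ss @ [S], ts @ [t]))"
    using fin by (subst sum.Sigma) (auto simp: finite_crossing_prefixes intro!: sum.cong)
  also have "\<dots> = (\<Sum>(Ss, ts)\<in>crossing_prefixes l n. \<Sum>S\<in>pairs (starting_shore l Ss ts n).
      \<Sum>t\<in>{1..l} - (starting_shore l Ss ts n - S). f (Ss @ [S], ts @ [t]))"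
    using fin by (intro sum.cong refl) (auto simp: sum.Sigma)
  finally show ?thesis .
qed

lemma return_weight_append:
  assumes "length Ss = n" "length ts = n"
  shows "return_weight z l n (Ss @ Ss') (ts @ ts') = return_weight z l n Ss ts"
  using assms unfolding return_weight_def
  by (intro prod.cong) (simp_all add: opposite_shore_append nth_append)

lemma return_weight_snoc:
  assumes "length Ss = n" "length ts = n"
  shows "return_weight z l (Suc n) (Ss @ [S]) (ts @ [t]) =
    return_weight z l n Ss ts *
      (if t = Max ({1..l} - (starting_shore l Ss ts n - S)) then z else 1)"
proof -
  have "return_weight z l (Suc n) (Ss @ [S]) (ts @ [t]) =
    return_weight z l n (Ss @ [S]) (ts @ [t]) *
      (if t = Max (opposite_shore l (Ss @ [S]) (ts @ [t]) n) then z else 1)"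
    using assms by (simp add: return_weight_def nth_append)
  with assms show ?thesis
    by (simp add: return_weight_append opposite_shore_snoc)
qed

text \<open>Exactly one element attains the maximum and contributes \<open>z\<close>; each of the
  other \<open>n\<close> contributes 1.\<close>

lemma sum_mark_Max:
  fixes z :: "'a::comm_ring_1"
  assumes "finite A" "card A = Suc n"
  shows "(\<Sum>t\<in>A. if t = Max A then z else 1) = of_nat n + z"
proof -
  have "A \<noteq> {}" using assms by auto
  then have "Max A \<in> A" using assms by simp
  then have "(\<Sum>t\<in>A. if t = Max A then z else 1) = z + (\<Sum>t\<in>A - {Max A}. 1)"
    using assms by (simp add: sum.remove)
  also have "\<dots> = of_nat n + z"
    using assms \<open>Max A \<in> A\<close> by (simp add: add.commute)
  finally show ?thesis .
qed

text \<open>In the round with index \<open>n\<close>, each prefix allows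
  \<open>(l - n) choose 2\<close> sends, and each send allows \<open>n + 2\<close> returns, one of
  them weighted by \<open>z\<close>. These counts depend on \<open>n\<close> alone, so the inner
  sums come out as a common factor.\<close>

lemma sum_return_weight:
  fixes z :: "'a::comm_ring_1"
  shows "(\<Sum>(Ss, ts)\<in>crossing_prefixes l n. return_weight z l n Ss ts) =
    (\<Prod>k<n. of_nat ((l - k) choose 2) * (of_nat (Suc k) + z))"
proof (induction n)
  case 0
  then show ?case by (simp add: crossing_prefixes_0 return_weight_def)
next
  case (Suc n)
  have "(\<Sum>(Ss, ts)\<in>crossing_prefixes l (Suc n). return_weight z l (Suc n) Ss ts) =
    (\<Sum>(Ss, ts)\<in>crossing_prefixes l n. return_weight z l n Ss ts *
      (of_nat ((l - n) choose 2) * (of_nat (Suc n) + z)))"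
  proof -
    have "(\<Sum>S\<in>pairs (starting_shore l Ss ts n). \<Sum>t\<in>{1..l} - (starting_shore l Ss ts n - S).
        return_weight z l (Suc n) (Ss @ [S]) (ts @ [t])) =
      return_weight z l n Ss ts * (of_nat ((l - n) choose 2) * (of_nat (Suc n) + z))"
      if p: "(Ss, ts) \<in> crossing_prefixes l n" for Ss ts
    proof -
      let ?A = "starting_shore l Ss ts n"
      have len: "length Ss = n" "length ts = n"
        using p by (auto simp: crossing_prefixes_def)
      have "(\<Sum>t\<in>{1..l} - (?A - S). return_weight z l (Suc n) (Ss @ [S]) (ts @ [t])) =
        return_weight z l n Ss ts * (of_nat (Suc n) + z)" if "S \<in> pairs ?A" for S
        unfolding return_weight_snoc[OF len] sum_distrib_left[symmetric]
        using card_opposite_prefix[OF p that] by (subst sum_mark_Max[of _ "Suc n"]) simp_all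
      moreover have "card (pairs ?A) = (l - n) choose 2"
        using starting_shore_prefix[OF p] by (subst card_pairs) (auto intro: finite_subset)
      ultimately show ?thesis
        by (simp add: ac_simps)
    qed
    then show ?thesis
      unfolding sum_crossing_prefixes_Suc by (intro sum.cong refl) auto
  qed
  also have "\<dots> = (\<Sum>(Ss, ts)\<in>crossing_prefixes l n. return_weight z l n Ss ts) *
      (of_nat ((l - n) choose 2) * (of_nat (Suc n) + z))"
    by (simp add: sum_distrib_right case_prod_unfold)
  finally show ?case
    by (simp add: Suc.IH)
qed

section \<open>Full boat sequences as prefixes with a forced last send\<close>

lemma boat_sequences_eq_image:
  assumes "l \<ge> 2"
  shows "boat_sequences l = (\<lambda>(Ss, ts). (Ss @ [starting_shore l Ss ts (l - 2)], ts)) `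
    crossing_prefixes l (l - 2)" (is "_ = ?f ` _")
proof (intro equalityI subsetI)
  have l: "l - 1 = Suc (l - 2)" using assms by simp
  fix x assume "x \<in> boat_sequences l"
  then obtain Ss S ts where x: "x = (Ss @ [S], ts)" "(Ss @ [S], ts) \<in> boat_sequences l"
    and len: "length Ss = l - 2" "length ts = l - 2"
    unfolding boat_sequences_def l by (auto simp: length_Suc_conv_rev)
  have p: "(Ss, ts) \<in> crossing_prefixes l (l - 2)"
    using x(2) len starting_shore_append[of _ Ss ts l "[S]" "[]"]
      opposite_shore_append[of _ Ss ts l "[S]" "[]"]
    unfolding boat_sequences_def l
    by (auto simp: crossing_prefixes_def pairs_def nth_append less_Suc_eq)
  have S: "S \<subseteq> starting_shore l Ss ts (l - 2)" "card S = 2"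
    using x(2) len starting_shore_append[of "l - 2" Ss ts l "[S]" "[]"]
    unfolding boat_sequences_def l by (auto simp: nth_append less_Suc_eq)
  \<comment> \<open>After \<open>l - 2\<close> rounds exactly two people are left on the starting
    shore, so the last pair can only be all of them.\<close>
  have "S = starting_shore l Ss ts (l - 2)"
    using S starting_shore_prefix[OF p] assms by (intro card_subset_eq) (auto intro: finite_subset)
  with x(1) p show "x \<in> ?f ` crossing_prefixes l (l - 2)"
    by force
next
  have l: "l - 1 = Suc (l - 2)" using assms by simp
  fix x assume "x \<in> ?f ` crossing_prefixes l (l - 2)"
  then obtain Ss ts where p: "(Ss, ts) \<in> crossing_prefixes l (l - 2)"
    and x: "x = (Ss @ [starting_shore l Ss ts (l - 2)], ts)" by auto
  have len: "length Ss = l - 2" "length ts = l - 2"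
    using p by (auto simp: crossing_prefixes_def)
  have "card (starting_shore l Ss ts (l - 2)) = 2"
    using starting_shore_prefix(2)[OF p] assms by simp
  then show "x \<in> boat_sequences l"
    using p len starting_shore_append[of _ Ss ts l "[starting_shore l Ss ts (l - 2)]" "[]"]
      opposite_shore_append[of _ Ss ts l "[starting_shore l Ss ts (l - 2)]" "[]"]
    unfolding x boat_sequences_def l
    by (auto simp: crossing_prefixes_def pairs_def nth_append less_Suc_eq)
qed

text \<open>The last send \<open>S\<close> is arbitrary: only the opposite shores at indices below
  \<open>l - 2\<close> count, and these do not see it.\<close>

lemma power_best_returns:
  assumes "l \<ge> 2" "(Ss, ts) \<in> crossing_prefixes l (l - 2)"
  shows "z ^ best_returns l (Ss @ [S], ts) = return_weight z l (l - 2) Ss ts"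
proof -
  have len: "length Ss = l - 2" "length ts = l - 2"
    using assms by (auto simp: crossing_prefixes_def)
  let ?B = "{i. i < l - 2 \<and> ts ! i = Max (opposite_shore l Ss ts i)}"
  have "z ^ best_returns l (Ss @ [S], ts) = z ^ card ?B"
    using len opposite_shore_append[of _ Ss ts l "[S]" "[]"]
    by (auto simp: best_returns_def intro!: arg_cong[where f = "\<lambda>A. z ^ card A"])
  also have "\<dots> = (\<Prod>i\<in>?B. z)" by simp
  also have "\<dots> = return_weight z l (l - 2) Ss ts"
    unfolding return_weight_def by (subst prod.inter_filter[symmetric]) (auto intro: prod.cong)
  finally show ?thesis .
qed

lemma sum_power_best_returns:
  fixes z :: "'a::comm_ring_1"
  assumes "l \<ge> 2"
  shows "(\<Sum>b\<in>boat_sequences l. z ^ best_returns l b) =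
    (\<Prod>k<l - 2. of_nat ((l - k) choose 2) * (of_nat (Suc k) + z))"
proof -
  have "(\<Sum>b\<in>boat_sequences l. z ^ best_returns l b) =
    (\<Sum>(Ss, ts)\<in>crossing_prefixes l (l - 2). return_weight z l (l - 2) Ss ts)"
    unfolding boat_sequences_eq_image[OF assms]
    by (subst sum.reindex)
       (auto simp: inj_on_def power_best_returns[OF assms] intro!: sum.cong)
  then show ?thesis
    by (simp add: sum_return_weight)
qed

text \<open>Dividing by the value at \<open>z = 1\<close> cancels the binomial coefficients and
  leaves \<open>(k + 1 + z) / (k + 2)\<close>, the generating function of a Bernoulli variable with
  parameter \<open>1 / (k + 2)\<close>.\<close>

lemma average_power_best_returns:
  fixes z :: complex
  assumes "l \<ge> 2"
  shows "(\<Sum>b\<in>boat_sequences l. z ^ best_returns l b) / card (boat_sequences l) =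
    (\<Prod>k<l - 2. 1 + (z - 1) / of_nat (k + 2))"
proof -
  let ?c = "\<lambda>k. of_nat ((l - k) choose 2) :: complex"
  have "of_nat (card (boat_sequences l)) = (\<Prod>k<l - 2. ?c k * (of_nat (Suc k) + 1))"
    using sum_power_best_returns[OF assms, of "1 :: complex"] by simp
  then have "(\<Sum>b\<in>boat_sequences l. z ^ best_returns l b) / card (boat_sequences l) =
    (\<Prod>k<l - 2. (?c k * (of_nat (Suc k) + z)) / (?c k * (of_nat (Suc k) + 1)))"
    by (simp only: sum_power_best_returns[OF assms] prod_dividef)
  also have "\<dots> = (\<Prod>k<l - 2. 1 + (z - 1) / of_nat (k + 2))"
  proof (intro prod.cong refl)
    fix k assume "k \<in> {..<l - 2}"
    \<comment> \<open>Here \<open>l - k > 2\<close>, so the number of pairs is nonzero and may be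
      cancelled.\<close>
    then have "?c k \<noteq> 0" by (simp add: binomial_eq_0_iff)
    moreover have "(of_nat k + 2 :: complex) \<noteq> 0"
      by (metis of_nat_add of_nat_eq_0_iff of_nat_numeral add_is_0 zero_neq_numeral)
    moreover have "c * (of_nat (Suc k) + z) / (c * (of_nat (Suc k) + 1)) =
      1 + (z - 1) / of_nat (k + 2)" if "c \<noteq> 0" "(of_nat k + 2 :: complex) \<noteq> 0" for c
      using that by (simp add: add_divide_eq_iff add_ac)
    ultimately show "?c k * (of_nat (Suc k) + z) / (?c k * (of_nat (Suc k) + 1)) =
      1 + (z - 1) / of_nat (k + 2)" by blast
  qed
  finally show ?thesis .
qed

section \<open>Asymptotics of the characteristic function\<close>

text \<open>This is the first-order Taylor remainder; on the unit disc its factor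
  \<open>exp \<bar>Re u\<bar>\<close> is at most \<open>exp 1\<close>.\<close>

lemma norm_exp_minus_one_minus:
  fixes u :: complex
  assumes "norm u \<le> 1"
  shows "norm (1 + u - exp u) \<le> exp 1 * (norm u)\<^sup>2"
proof -
  have "norm (1 + u - exp u) = norm (exp u - (\<Sum>i\<le>1. u ^ i / fact i))"
    by (simp add: norm_minus_commute)
  also have "\<dots> \<le> exp \<bar>Re u\<bar> * norm u ^ Suc 1 / fact 1"
    by (rule Taylor_exp)
  also have "\<dots> \<le> exp 1 * (norm u)\<^sup>2"
    using assms abs_Re_le_cmod[of u] by (simp add: power2_eq_square mult_right_mono)
  finally show ?thesis .
qed

lemma sum_inverse_squares_le: "(\<Sum>k<n. 1 / (real (k + 2))\<^sup>2) \<le> 1"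
proof -
  \<comment> \<open>The subtracted \<open>1 / (n + 1)\<close> makes the induction telescope.\<close>
  have "(\<Sum>k<n. 1 / (real (k + 2))\<^sup>2) \<le> 1 - 1 / real (n + 1)"
  proof (induction n)
    case (Suc n)
    have "1 / (real (n + 2))\<^sup>2 \<le> 1 / (real (n + 1) * real (n + 2))"
      by (intro divide_left_mono) (auto simp: power2_eq_square)
    also have "\<dots> = 1 / real (n + 1) - 1 / real (n + 2)"
      by (simp add: field_simps)
    finally show ?case
      using Suc by simp
  qed simp
  also have "\<dots> \<le> 1" by simp
  finally show ?thesis .
qed

text \<open>With \<open>w = z - 1\<close> the hypothesis puts \<open>z\<close> in the closed unit
  disc. Then all factors of both products have norm at most 1, so the products differ by at most the
  sum of the differences of their factors. This sum is of order \<open>(norm w)^2\<close> because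
  the inverse squares are summable.\<close>

lemma norm_prod_minus_exp_sum:
  fixes w :: complex
  assumes "norm (1 + w) \<le> 1"
  shows "norm ((\<Prod>k<n. 1 + w / of_nat (k + 2)) -
      exp (w * of_real (\<Sum>k<n. 1 / real (k + 2)))) \<le> exp 1 * (norm w)\<^sup>2"
proof -
  \<comment> \<open>The bound 2 matches the smallest denominator \<open>k + 2\<close>: each
    \<open>w / (k + 2)\<close> lies in the unit disc, as the Taylor estimate requires.\<close>
  have w2: "norm w \<le> 2"
    using norm_triangle_ineq4[of "1 + w" 1] assms by simp
  \<comment> \<open>A nonpositive real part of \<open>w\<close> keeps the exponential factors in the
    unit disc.\<close>
  have "Re (1 + w) \<le> 1"
    using complex_Re_le_cmod[of "1 + w"] assms by linarith
  then have Re: "Re w \<le> 0" by simp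
  have "norm ((\<Prod>k<n. 1 + w / of_nat (k + 2)) - (\<Prod>k<n. exp (w / of_nat (k + 2)))) \<le>
    (\<Sum>k<n. norm (1 + w / of_nat (k + 2) - exp (w / of_nat (k + 2))))"
  proof (rule norm_prod_diff)
    fix k
    have "(of_real (real (k + 2)) :: complex) \<noteq> 0"
      unfolding of_real_eq_0_iff of_nat_eq_0_iff by simp
    \<comment> \<open>A convex combination of \<open>1\<close> and \<open>1 + w\<close>, with
      weights \<open>(k + 1) / (k + 2)\<close> and \<open>1 / (k + 2)\<close>.\<close>
    then have "1 + w / of_nat (k + 2) = (of_real (real k + 1) + (1 + w)) / of_real (real (k + 2))"
      by (simp add: add_divide_eq_iff add_ac)
    then have "norm (1 + w / of_nat (k + 2)) =
        norm (of_real (real k + 1) + (1 + w)) / real (k + 2)"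
      by (simp only: norm_divide norm_of_real abs_of_nat)
    moreover have "norm (of_real (real k + 1) + (1 + w)) \<le> norm (of_real (real k + 1) :: complex) + norm (1 + w)"
      by (rule norm_triangle_ineq)
    moreover have "norm (of_real (real k + 1) :: complex) = real k + 1"
      by (simp only: norm_of_real)
    ultimately show "norm (1 + w / of_nat (k + 2)) \<le> 1"
      using assms by simp
    have "Re (w / of_nat (k + 2)) = Re w / real (k + 2)"
      by (rule Re_divide_of_nat)
    then show "norm (exp (w / of_nat (k + 2))) \<le> 1"
      using Re by (simp only: norm_exp_eq_Re) (simp add: divide_nonpos_nonneg)
  qed
  also have "\<dots> \<le> (\<Sum>k<n. exp 1 * (norm w)\<^sup>2 * (1 / (real (k + 2))\<^sup>2))"
  proof (rule sum_mono)
    fix k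
    have n: "norm (w / of_nat (k + 2)) = norm w / real (k + 2)"
      by (simp only: norm_divide norm_of_nat)
    have "norm w / real (k + 2) \<le> 1"
      using w2 by (simp add: divide_simps)
    then have "norm (1 + w / of_nat (k + 2) - exp (w / of_nat (k + 2))) \<le>
        exp 1 * (norm w / real (k + 2))\<^sup>2"
      using norm_exp_minus_one_minus[of "w / of_nat (k + 2)"] unfolding n by blast
    then show "norm (1 + w / of_nat (k + 2) - exp (w / of_nat (k + 2))) \<le>
        exp 1 * (norm w)\<^sup>2 * (1 / (real (k + 2))\<^sup>2)"
      by (simp only: power_divide times_divide_eq_right mult_1_right)
  qed
  also have "\<dots> = exp 1 * (norm w)\<^sup>2 * (\<Sum>k<n. 1 / (real (k + 2))\<^sup>2)"
    by (rule sum_distrib_left[symmetric])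
  also have "\<dots> \<le> exp 1 * (norm w)\<^sup>2"
    using sum_inverse_squares_le[of n] by (intro mult_left_le) auto
  also have "(\<Prod>k<n. exp (w / of_nat (k + 2))) = exp (w * of_real (\<Sum>k<n. 1 / real (k + 2)))"
    by (subst exp_sum[symmetric]) (simp_all add: sum_distrib_left)
  finally show ?thesis .
qed

section \<open>Limits entering the exponent\<close>

lemma sum_reciprocals_minus_ln:
  "(\<lambda>l. (\<Sum>k<l - 2. 1 / real (k + 2)) - ln (real l)) \<longlonglongrightarrow> euler_mascheroni - 1"
proof -
  \<comment> \<open>The sum runs from \<open>1 / 2\<close> to \<open>1 / (n + 1)\<close>, so it
    lacks the first and the last term of \<open>harm (n + 2)\<close>.\<close>
  have *: "(\<Sum>k<n. 1 / real (k + 2)) = harm (n + 2) - 1 - 1 / real (n + 2)" for n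
    by (induction n) (simp_all add: harm_Suc harm_expand(1) numeral_2_eq_2 inverse_eq_divide add_ac)
  have "(\<Sum>k<l - 2. 1 / real (k + 2)) = harm l - 1 - 1 / real l" if "l \<ge> 2" for l
    using *[of "l - 2"] unfolding le_add_diff_inverse2[OF that] .
  then have eq: "\<forall>\<^sub>F l in sequentially. harm l - ln (real l) - 1 - 1 / real l =
      (\<Sum>k<l - 2. 1 / real (k + 2)) - ln (real l)"
    by (intro eventually_sequentiallyI[of 2]) (simp add: algebra_simps)
  have "(\<lambda>l. harm l - ln (real l) - 1 - 1 / real l) \<longlonglongrightarrow> euler_mascheroni - 1 - 0"
    by (intro tendsto_intros euler_mascheroni_LIMSEQ lim_1_over_n)
  from Lim_transform_eventually[OF this eq] show ?thesis
    by (simp only: diff_0_right)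
qed

text \<open>By second-order Taylor expansion, \<open>r^2 * (iexp (t / r) - 1)\<close> is
  \<open>\<i> * t * r - t^2 / 2\<close> up to an error of order \<open>1 / r\<close>. The divergent
  linear term is the one that centering by \<open>ln l\<close> removes when
  \<open>r = sqrt (ln l)\<close>.\<close>

lemma scaled_iexp_limit:
  fixes s :: "nat \<Rightarrow> real"
  assumes "filterlim s at_top sequentially"
  shows "(\<lambda>n. of_real ((s n)\<^sup>2) * (iexp (t / s n) - 1) - \<i> * of_real (t * s n))
    \<longlonglongrightarrow> of_real (- t\<^sup>2 / 2)"
proof -
  have bound: "norm (of_real (r\<^sup>2) * (iexp (t / r) - 1) - \<i> * of_real (t * r) - of_real (- t\<^sup>2 / 2))
      \<le> \<bar>t\<bar> ^ 3 / 6 * inverse r" if "r > 0" for r :: real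
  proof -
    have "of_real (r\<^sup>2) * (iexp (t / r) - 1) - \<i> * of_real (t * r) - of_real (- t\<^sup>2 / 2) =
      of_real (r\<^sup>2) * (iexp (t / r) - (\<Sum>k\<le>2. (\<i> * of_real (t / r)) ^ k / fact k))"
      using that by (simp add: eval_nat_numeral field_simps)
    also have "norm \<dots> = r\<^sup>2 * norm (iexp (t / r) - (\<Sum>k\<le>2. (\<i> * of_real (t / r)) ^ k / fact k))"
      by (simp only: norm_mult norm_of_real abs_power2)
    also have "\<dots> \<le> r\<^sup>2 * (\<bar>t / r\<bar> ^ 3 / 6)"
      using iexp_approx1[of "t / r" 2]
      by (intro mult_left_mono) (simp_all add: eval_nat_numeral)
    also have "\<dots> = \<bar>t\<bar> ^ 3 / 6 * inverse r"
      using that by (simp add: field_simps power3_eq_cube power2_eq_square abs_mult)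
    finally show ?thesis .
  qed
  have "\<forall>\<^sub>F n in sequentially. s n > 0"
    using assms by (simp add: filterlim_at_top_dense)
  then have "\<forall>\<^sub>F n in sequentially. norm (of_real ((s n)\<^sup>2) * (iexp (t / s n) - 1) -
      \<i> * of_real (t * s n) - of_real (- t\<^sup>2 / 2)) \<le> \<bar>t\<bar> ^ 3 / 6 * inverse (s n)"
    by eventually_elim (rule bound)
  moreover have "(\<lambda>n. \<bar>t\<bar> ^ 3 / 6 * inverse (s n)) \<longlonglongrightarrow> 0"
    using tendsto_inverse_0_at_top[OF assms] by (rule tendsto_mult_right_zero)
  ultimately have "(\<lambda>n. of_real ((s n)\<^sup>2) * (iexp (t / s n) - 1) - \<i> * of_real (t * s n) -
      of_real (- t\<^sup>2 / 2)) \<longlonglongrightarrow> 0"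
    by (rule Lim_null_comparison)
  then show ?thesis
    by (rule LIM_zero_cancel)
qed

section \<open>Characteristic functions and the normal limit\<close>

lemma char_best_returns:
  assumes "l \<ge> 2"
  shows "char (distr (measure_pmf (pmf_of_set (boat_sequences l))) borel
      (\<lambda>b. (real (best_returns l b) - a) / s)) t =
    exp (- (\<i> * of_real (t * a / s))) * (\<Prod>k<l - 2. 1 + (iexp (t / s) - 1) / of_nat (k + 2))"
proof -
  let ?B = "boat_sequences l"
  have "char (distr (measure_pmf (pmf_of_set ?B)) borel (\<lambda>b. (real (best_returns l b) - a) / s)) t =
    (\<integral>b. iexp (t * ((real (best_returns l b) - a) / s)) \<partial>measure_pmf (pmf_of_set ?B))"
    unfolding char_def by (subst integral_distr) auto
  also have "\<dots> = (\<Sum>b\<in>?B. pmf (pmf_of_set ?B) b *\<^sub>R iexp (t * ((real (best_returns l b) - a) / s)))"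
    by (intro integral_measure_pmf) (simp_all add: finite_boat_sequences boat_sequences_nonempty)
  also have "\<dots> = (\<Sum>b\<in>?B. exp (- (\<i> * of_real (t * a / s))) * iexp (t / s) ^ best_returns l b / card ?B)"
  proof (intro sum.cong refl)
    fix b assume "b \<in> ?B"
    \<comment> \<open>Splitting off the deterministic centering leaves a power of
      \<open>iexp (t / s)\<close>, so the average becomes the generating function at
      \<open>z = iexp (t / s)\<close>.\<close>
    have "iexp (t * ((real (best_returns l b) - a) / s)) =
      exp (- (\<i> * of_real (t * a / s)) + of_nat (best_returns l b) * (\<i> * of_real (t / s)))"
      by (intro arg_cong[where f = exp]) (simp add: diff_divide_distrib algebra_simps)
    also have "\<dots> = exp (- (\<i> * of_real (t * a / s))) * iexp (t / s) ^ best_returns l b"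
      by (simp only: exp_add exp_of_nat_mult)
    finally show "pmf (pmf_of_set ?B) b *\<^sub>R iexp (t * ((real (best_returns l b) - a) / s)) =
        exp (- (\<i> * of_real (t * a / s))) * iexp (t / s) ^ best_returns l b / card ?B"
      using \<open>b \<in> ?B\<close>
      by (simp add: finite_boat_sequences boat_sequences_nonempty scaleR_conv_of_real divide_simps)
  qed
  also have "\<dots> = exp (- (\<i> * of_real (t * a / s))) *
      ((\<Sum>b\<in>?B. iexp (t / s) ^ best_returns l b) / card ?B)"
    by (simp add: sum_distrib_left sum_divide_distrib)
  finally show ?thesis
    by (simp only: average_power_best_returns[OF assms])
qed

theorem theorem1:
  "weak_conv_m
     (\<lambda>l. distr (measure_pmf (pmf_of_set (boat_sequences l))) borel
            (\<lambda>b. (real (best_returns l b) - ln (real l)) / sqrt (ln (real l))))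
     std_normal_distribution"
proof (rule levy_continuity)
  fix t :: real
  define s where "s = (\<lambda>l. sqrt (ln (real l)))"
  define w where "w = (\<lambda>l. iexp (t / s l) - 1)"
  define h where "h = (\<lambda>l. \<Sum>k<l - 2. 1 / real (k + 2))"
  define \<phi> where "\<phi> = (\<lambda>l. char (distr (measure_pmf (pmf_of_set (boat_sequences l))) borel
      (\<lambda>b. (real (best_returns l b) - ln (real l)) / sqrt (ln (real l)))) t)"
  have s: "filterlim s at_top sequentially"
    unfolding s_def
    by (intro filterlim_compose[OF sqrt_at_top] filterlim_compose[OF ln_at_top]
          filterlim_real_sequentially)
  have s2: "(s l)\<^sup>2 = ln (real l)" if "l \<ge> 2" for l
    using that by (simp add: s_def)
  have "(\<lambda>l. t * inverse (s l)) \<longlonglongrightarrow> 0"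
    using tendsto_inverse_0_at_top[OF s] by (rule tendsto_mult_right_zero)
  then have "(\<lambda>l. iexp (t * inverse (s l))) \<longlonglongrightarrow> iexp 0"
    by (rule isCont_tendsto_compose[OF isCont_iexp])
  then have w: "w \<longlonglongrightarrow> 0"
    unfolding w_def divide_inverse by (intro LIM_zero) simp
  have h: "(\<lambda>l. h l - ln (real l)) \<longlonglongrightarrow> euler_mascheroni - 1"
    unfolding h_def by (rule sum_reciprocals_minus_ln)
  \<comment> \<open>The exponent \<open>w l * h l - \<i> * t * s l\<close> is regrouped around
    \<open>(s l)^2 = ln l\<close>. The first bracket has the Gaussian limit; the rest vanishes
    because \<open>w\<close> tends to 0 while \<open>h l - ln l\<close> converges.\<close>
  have "(\<lambda>l. (of_real ((s l)\<^sup>2) * w l - \<i> * of_real (t * s l)) + w l * of_real (h l - ln (real l)))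
    \<longlonglongrightarrow> of_real (- t\<^sup>2 / 2) + 0 * of_real (euler_mascheroni - 1)"
    unfolding w_def
    by (intro tendsto_add tendsto_mult tendsto_of_real scaled_iexp_limit s h
          w[unfolded w_def])
  then have "(\<lambda>l. exp ((of_real ((s l)\<^sup>2) * w l - \<i> * of_real (t * s l)) +
      w l * of_real (h l - ln (real l)))) \<longlonglongrightarrow> exp (of_real (- t\<^sup>2 / 2))"
    by (intro tendsto_exp) simp
  moreover have "\<forall>\<^sub>F l in sequentially.
    exp ((of_real ((s l)\<^sup>2) * w l - \<i> * of_real (t * s l)) + w l * of_real (h l - ln (real l))) =
    exp (- (\<i> * of_real (t * s l))) * exp (w l * of_real (h l))"
    unfolding exp_add[symmetric]
    by (intro eventually_sequentiallyI[of 2] arg_cong[where f = exp]) (simp add: s2 algebra_simps)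
  ultimately have main: "(\<lambda>l. exp (- (\<i> * of_real (t * s l))) * exp (w l * of_real (h l)))
      \<longlonglongrightarrow> exp (of_real (- t\<^sup>2 / 2))"
    by (rule Lim_transform_eventually)
  have bound: "norm (\<phi> l - exp (- (\<i> * of_real (t * s l))) * exp (w l * of_real (h l)))
      \<le> exp 1 * (norm (w l))\<^sup>2" if l: "l \<ge> 2" for l
  proof -
    \<comment> \<open>This is the centering term \<open>t * a / s\<close> of the characteristic
      function for \<open>a = ln l\<close> and \<open>s = sqrt (ln l)\<close>.\<close>
    have "t * ln (real l) / sqrt (ln (real l)) = t * s l"
      using l by (simp add: s_def real_div_sqrt flip: times_divide_eq_right)
    then have "\<phi> l = exp (- (\<i> * of_real (t * s l))) * (\<Prod>k<l - 2. 1 + w l / of_nat (k + 2))"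
      unfolding \<phi>_def char_best_returns[OF l] w_def by (simp add: s_def)
    then have "\<phi> l - exp (- (\<i> * of_real (t * s l))) * exp (w l * of_real (h l)) =
      exp (- (\<i> * of_real (t * s l))) *
        ((\<Prod>k<l - 2. 1 + w l / of_nat (k + 2)) - exp (w l * of_real (h l)))"
      by (simp only: right_diff_distrib)
    moreover have "norm (exp (- (\<i> * of_real (t * s l)))) = 1"
      by (simp add: norm_exp_eq_Re)
    moreover have "norm (1 + w l) \<le> 1"
      by (simp add: w_def)
    ultimately show ?thesis
      using norm_prod_minus_exp_sum[of "w l" "l - 2"] by (simp add: norm_mult h_def)
  qed
  \<comment> \<open>The constant in \<open>bound\<close> is the same for all \<open>l\<close>, so
    \<open>w\<close> tending to 0 suffices for \<open>\<phi>\<close> to share the limit of the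
    exponential.\<close>
  have "(\<lambda>l. exp 1 * (norm (w l))\<^sup>2) \<longlonglongrightarrow> exp 1 * (norm (0 :: complex))\<^sup>2"
    by (intro tendsto_intros w)
  then have "(\<lambda>l. exp 1 * (norm (w l))\<^sup>2) \<longlonglongrightarrow> 0"
    by simp
  with eventually_sequentiallyI[OF bound]
  have "(\<lambda>l. \<phi> l - exp (- (\<i> * of_real (t * s l))) * exp (w l * of_real (h l))) \<longlonglongrightarrow> 0"
    by (rule Lim_null_comparison)
  then have "\<phi> \<longlonglongrightarrow> exp (of_real (- t\<^sup>2 / 2))"
    by (rule Lim_transform[OF main])
  then show "(\<lambda>l. char (distr (measure_pmf (pmf_of_set (boat_sequences l))) borel
      (\<lambda>b. (real (best_returns l b) - ln (real l)) / sqrt (ln (real l)))) t)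
      \<longlonglongrightarrow> char std_normal_distribution t"
    by (simp only: \<phi>_def char_std_normal_distribution exp_of_real minus_divide_left)
next
  fix l
  show "real_distribution (distr (measure_pmf (pmf_of_set (boat_sequences l))) borel
      (\<lambda>b. (real (best_returns l b) - ln (real l)) / sqrt (ln (real l))))"
    by (rule prob_space.real_distribution_distr[OF prob_space_measure_pmf]) simp
qed (rule real_dist_normal_dist)

end
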